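(* Let $\mathcal{F}$ be a family of compact connected sets in $\mathbb{R}^2$ with property $T(3)$. Then there are three lines in the plane whose union intersects every set in $\mathcal{F}$.
   Context: A family $\mathcal{F}$ of sets in the plane has property $T(3)$ if for every three or fewer sets in $\mathcal{F}$ there exists a line intersecting all of these sets. The family is not assumed to be finite. *)

theory Defs
  imports "HOL-Analysis.Analysis"
begin

definition is_line :: "(real ^ 2) set \<Rightarrow> bool" where
  "is_line L \<longleftrightarrow> affine L \<and> aff_dim L = 1"

(* Taking G to be a singleton shows that every member of F is nonempty. *)
definition property_T :: "nat \<Rightarrow> (real ^ 2) set set \<Rightarrow> bool" where
  "property_T k F \<longleftrightarrow>
     (\<forall>G \<subseteq> F. finite G \<and> card G \<le> k \<longrightarrow>
        (\<exists>L. is_line L \<and> (\<forall>C \<in> G. L \<inter> C \<noteq> {})))"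

end

theory Submission
  imports Defs
begin

text \<open>
  The proof follows McGinnis and Zerbib. First let the family be finite and contained in an open
  disc. A point of the five-dimensional simplex cuts the boundary circle into six consecutive
  arcs, and the three chords joining opposite division points define three lines. Adjacent lines
  bound a sector of the disc over each of the six arcs; the sector over a degenerate arc is empty,
  and a connected set that avoids the three lines lies in one of the six sectors. If no choice of
  division points worked, the KKM lemma would give a choice for which every sector contains a
  member of the family. The central triangle cut out by the lines has only one of its two possible
  orientations, and depending on which one it is, no line meets the three odd sectors or no line
  meets the three even ones. This contradicts \<open>T(3)\<close>.

  An arbitrary family is reduced to its finite subfamilies by compactness of the space of triples
  of lines in the projective plane: the line at infinity meets no member of the family.
\<close>

section \<open>A KKM lemma on the simplex\<close>

definition std_simplex :: "(real ^ 'n::finite) set" where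
  "std_simplex = {x. (\<forall>i. 0 \<le> x $ i) \<and> (\<Sum>i\<in>UNIV. x $ i) = 1}"

lemma compact_std_simplex: "compact (std_simplex :: (real ^ 'n::finite) set)"
proof (rule compact_eq_bounded_closed[THEN iffD2], intro conjI)
  have "norm x \<le> 1" if "x \<in> std_simplex" for x :: "real ^ 'n"
    using norm_le_l1_cart[of x] that by (simp add: std_simplex_def)
  then show "bounded (std_simplex :: (real ^ 'n) set)"
    by (auto simp: bounded_iff)
  show "closed (std_simplex :: (real ^ 'n) set)"
    unfolding std_simplex_def
    by (intro closed_Collect_conj closed_Collect_all closed_Collect_le closed_Collect_eq
        continuous_intros)
qed

lemma convex_std_simplex: "convex (std_simplex :: (real ^ 'n::finite) set)"
  unfolding std_simplex_def convex_def
  by (auto simp: sum.distrib simp flip: sum_distrib_left)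

lemma std_simplex_nonempty: "(std_simplex :: (real ^ 'n::finite) set) \<noteq> {}"
proof -
  have "(\<chi> i. 1 / real CARD('n)) \<in> (std_simplex :: (real ^ 'n) set)"
    by (simp add: std_simplex_def)
  then show ?thesis by blast
qed

text \<open>If at every point some \<open>f i\<close> vanished, weighting coordinate
  \<open>i\<close> by the total amount by which \<open>f i\<close> falls below the other values
  would give a continuous self-map of the simplex, and Brouwer would apply.\<close>

lemma kkm_functions:
  fixes f :: "'n::finite \<Rightarrow> real ^ 'n \<Rightarrow> real"
  assumes cont: "\<And>i. continuous_on std_simplex (f i)"
    and nonneg: "\<And>i x. x \<in> std_simplex \<Longrightarrow> 0 \<le> f i x"
    and face: "\<And>i x. x \<in> std_simplex \<Longrightarrow> x $ i = 0 \<Longrightarrow> f i x = 0"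
    and cover: "\<And>x. x \<in> std_simplex \<Longrightarrow> \<exists>i. 0 < f i x"
  shows "\<exists>x\<in>std_simplex. \<forall>i. 0 < f i x"
proof (rule ccontr)
  assume "\<not> ?thesis"
  then have zero: "\<exists>i. f i x = 0" if "x \<in> std_simplex" for x
    using nonneg that by (metis less_eq_real_def)
  \<comment> \<open>A fixed point of \<open>\<phi>\<close> would vanish at an index \<open>k\<close> maximising \<open>f k\<close>, where \<open>face\<close> then forces \<open>f k = 0\<close>.\<close>
  define g where "g i x = (\<Sum>j\<in>UNIV. max 0 (f j x - f i x))" for i x
  define \<phi> where "\<phi> x = (\<chi> i. g i x / (\<Sum>j\<in>UNIV. g j x))" for x
  have g_nonneg: "0 \<le> g i x" for i x
    by (auto simp: g_def intro: sum_nonneg)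
  have g_sum: "0 < (\<Sum>j\<in>UNIV. g j x)" if "x \<in> std_simplex" for x
  proof -
    obtain i k where "f i x = 0" "0 < f k x"
      using zero cover \<open>x \<in> std_simplex\<close> by blast
    then have "0 < g i x"
      unfolding g_def by (intro sum_pos2[where i = k]) auto
    then show ?thesis
      using g_nonneg by (intro sum_pos2[where i = i]) auto
  qed
  have "continuous_on std_simplex \<phi>"
    unfolding \<phi>_def g_def using g_sum
    by (intro continuous_on_vec_lambda continuous_intros cont) (force simp: g_def)
  moreover have "\<phi> \<in> std_simplex \<rightarrow> std_simplex"
  proof
    fix x :: "real ^ 'n" assume "x \<in> std_simplex"
    then show "\<phi> x \<in> std_simplex"
      using g_sum[of x] g_nonneg[of _ x]
      by (simp add: std_simplex_def \<phi>_def flip: sum_divide_distrib)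
  qed
  ultimately obtain x where x: "x \<in> std_simplex" "\<phi> x = x"
    using brouwer[OF compact_std_simplex convex_std_simplex std_simplex_nonempty] by metis
  have "Max (range (\<lambda>i. f i x)) \<in> range (\<lambda>i. f i x)"
    by (intro Max_in) auto
  then obtain k where k: "f k x = Max (range (\<lambda>i. f i x))"
    by (metis imageE)
  have le: "f j x \<le> f k x" for j
    unfolding k by (intro Max_ge) auto
  then have "g k x = 0"
    by (simp add: g_def max_absorb1)
  then have "x $ k = 0"
    using x(2) by (metis \<phi>_def div_0 vec_lambda_beta)
  then have "f k x = 0"
    using face x(1) by blast
  then show False
    using cover[OF x(1)] le by (metis not_less)
qed

text \<open>The dual form of the KKM lemma: the sets avoid the opposite facets instead of covering the faces.\<close>

lemma kkm_open:
  fixes B :: "'n::finite \<Rightarrow> (real ^ 'n) set"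
  assumes opn: "\<And>i. openin (top_of_set std_simplex) (B i)"
    and face: "\<And>i x. x \<in> B i \<Longrightarrow> x $ i \<noteq> 0"
    and cover: "std_simplex \<subseteq> (\<Union>i. B i)"
  shows "\<exists>x\<in>std_simplex. \<forall>i. x \<in> B i"
proof (cases "\<exists>i. std_simplex \<subseteq> B i")
  case True
  then obtain i where i: "std_simplex \<subseteq> B i" ..
  \<comment> \<open>The vertex of any other index would lie in \<open>B i\<close> and also on the
    facet that \<open>B i\<close> avoids.\<close>
  have eq: "j = i" for j
  proof (rule ccontr)
    assume "j \<noteq> i"
    then have "axis j 1 \<in> (std_simplex :: (real ^ 'n) set)" "axis j 1 $ i = (0::real)"
      by (auto simp: std_simplex_def axis_def)
    then show False
      using i face by blast
  qed
  then show ?thesis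
    using i std_simplex_nonempty by (metis ex_in_conv subsetD)
next
  case False
  \<comment> \<open>Distance to the complement detects membership in \<open>B i\<close>. Since
    \<open>infdist\<close> to the empty set is 0, the case of an empty complement had to be split
    off.\<close>
  define f where "f i x = infdist x (std_simplex - B i)" for i x
  have closed: "closed (std_simplex - B i)" for i
    by (metis closedin_diff closedin_self closedin_closed_trans compact_imp_closed compact_std_simplex opn)
  have nonempty: "std_simplex - B i \<noteq> {}" for i
    using False by blast
  have f0: "f i x = 0 \<longleftrightarrow> x \<notin> B i" if "x \<in> std_simplex" for i x
    using in_closed_iff_infdist_zero[OF closed nonempty] that by (auto simp: f_def)
  have "\<exists>x\<in>std_simplex. \<forall>i. 0 < f i x"
  proof (rule kkm_functions)
    show "continuous_on std_simplex (f i)" for i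
      unfolding f_def by (intro continuous_intros)
    show "0 \<le> f i x" for i x
      by (simp add: f_def infdist_nonneg)
    show "f i x = 0" if "x \<in> std_simplex" "x $ i = 0" for i x
      using f0 face that by blast
    show "\<exists>i. 0 < f i x" if "x \<in> std_simplex" for x
      using cover that f0 infdist_nonneg by (metis UN_E f_def less_eq_real_def subsetD)
  qed
  then show ?thesis
    using f0 by (metis less_irrefl)
qed

text \<open>The set is the first projection of a compact set.\<close>

lemma closed_exists_compact:
  fixes K :: "'a::t2_space set" and C :: "'b::t2_space set"
  assumes "compact K" "compact C" "closed S"
  shows "closed {x \<in> K. \<exists>z\<in>C. (x, z) \<in> S}"
proof -
  have "compact (fst ` (K \<times> C \<inter> S))"
    using assms by (intro compact_continuous_image continuous_intros closed_Int_compact compact_Int_closed compact_Times)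
  moreover have "fst ` (K \<times> C \<inter> S) = {x \<in> K. \<exists>z\<in>C. (x, z) \<in> S}"
    by force
  ultimately show ?thesis
    by (simp add: compact_imp_closed)
qed

section \<open>Chords of a circle\<close>

definition dir :: "real \<Rightarrow> real ^ 2" where
  "dir m = vector [cos m, sin m]"

lemma inner_dir: "dir m \<bullet> z = cos m * z $ 1 + sin m * z $ 2"
  by (simp add: dir_def inner_vec_def sum_2)

lemma norm_dir [simp]: "norm (dir m) = 1"
  by (simp add: dir_def norm_eq_sqrt_inner inner_vec_def sum_2 flip: power2_eq_square)

text \<open>Defines the line through the points of the circle of radius \<open>R\<close> at angles \<open>a\<close> and \<open>b\<close> (the tangent
  if they coincide); the function is positive on the arc from \<open>a\<close> to \<open>b\<close> when \<open>a \<le> b \<le> a + 2 * pi\<close>.\<close>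

definition chord :: "real \<Rightarrow> real \<Rightarrow> real \<Rightarrow> real ^ 2 \<Rightarrow> real" where
  "chord R a b z = dir ((a + b) / 2) \<bullet> z - R * cos ((b - a) / 2)"

lemma chord_swap: "chord R b (a + 2 * pi) z = - chord R a b z"
proof -
  have 1: "(b + (a + 2 * pi)) / 2 = (a + b) / 2 + pi" and 2: "(a + 2 * pi - b) / 2 = pi - (b - a) / 2"
    by (simp_all add: field_simps)
  show ?thesis
    by (simp only: chord_def inner_dir 1 2 cos_periodic_pi sin_periodic_pi cos_pi_minus)
qed

text \<open>With \<open>a\<close> fixed, moving \<open>b\<close> forward enlarges the arc, and with
  it the cap of the disc behind the chord.\<close>

lemma chord_pos_mono:
  assumes z: "norm z < R" and "a \<le> b" "b \<le> b'" "b' \<le> a + 2 * pi"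
    and pos: "0 < chord R a b z"
  shows "0 \<le> chord R a b' z"
proof -
  \<comment> \<open>\<open>A\<close> is the distance of \<open>z\<close> from the tangent at
    \<open>a\<close>, positive inside the disc. In terms of half the arc, the chord function becomes
    \<open>B * sin - A * cos\<close>.\<close>
  define A where "A = R - dir a \<bullet> z"
  define B where "B = cos a * z $ 2 - sin a * z $ 1"
  have "dir a \<bullet> z \<le> norm z"
    using norm_cauchy_schwarz[of "dir a" z] by simp
  then have "0 < A"
    using z by (simp add: A_def)
  have eq: "chord R a c z = B * sin ((c - a) / 2) - A * cos ((c - a) / 2)" for c
  proof -
    have "(a + c) / 2 = a + (c - a) / 2"
      by (simp add: field_simps)
    then show ?thesis
      by (simp only: chord_def inner_dir cos_add sin_add A_def B_def) (simp add: algebra_simps)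
  qed
  define s where "s = (b - a) / 2"
  define t where "t = (b' - a) / 2"
  have st: "0 \<le> s" "s \<le> t" "t \<le> pi"
    using assms by (auto simp: s_def t_def)
  have ps: "0 < B * sin s - A * cos s"
    using pos by (simp add: eq s_def)
  consider "s = 0" | "s = pi" | "0 < s" "s < pi"
    using st by linarith
  then have "0 \<le> B * sin t - A * cos t"
  proof cases
    case 1
    then show ?thesis using ps \<open>0 < A\<close> by simp
  next
    case 2
    then have "t = s" using st by simp
    then show ?thesis using ps by simp
  next
    case 3
    then have "0 < sin s" by (rule sin_gt_zero)
    have "sin s * (B * sin t - A * cos t) = sin t * (B * sin s - A * cos s) + A * sin (t - s)"
      by (simp add: sin_diff algebra_simps)
    moreover have "0 \<le> sin t" "0 \<le> sin (t - s)"
      using st by (auto intro: sin_ge_zero)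
    ultimately have "0 \<le> sin s * (B * sin t - A * cos t)"
      using ps \<open>0 < A\<close> by simp
    then show ?thesis
      using \<open>0 < sin s\<close> by (simp add: zero_le_mult_iff)
  qed
  then show ?thesis
    by (simp add: eq t_def)
qed

text \<open>The two sign patterns describe the open central triangle in its two orientations, which
  exclude each other.\<close>

lemma chords_alternating:
  assumes "t0 < t1" "t1 < t2" "t2 < t3" "t3 < t4" "t4 < t5" "t5 < t0 + 2 * pi"
    and P: "0 < chord R t0 t3 p" "chord R t1 t4 p < 0" "0 < chord R t2 t5 p"
    and Q: "chord R t0 t3 q < 0" "0 < chord R t1 t4 q" "chord R t2 t5 q < 0"
  shows False
proof -
  define m0 where "m0 = (t0 + t3) / 2"
  define m1 where "m1 = (t1 + t4) / 2"
  define m2 where "m2 = (t2 + t5) / 2"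
  have m: "0 < m1 - m0" "m1 - m0 < pi" "0 < m2 - m1" "m2 - m1 < pi" "0 < m2 - m0" "m2 - m0 < pi"
    using assms(1-6) by (simp_all add: m0_def m1_def m2_def field_simps)
  \<comment> \<open>Coefficients of the linear relation between the three unit normals; they are
    positive because the angles of the normals increase by less than \<open>pi\<close> in
    total.\<close>
  define a where "a = sin (m2 - m1)"
  define b where "b = sin (m2 - m0)"
  define c where "c = sin (m1 - m0)"
  have pos: "0 < a" "0 < b" "0 < c"
    using m by (auto simp: a_def b_def c_def intro: sin_gt_zero)
  have 1: "a * cos m0 - b * cos m1 + c * cos m2 = 0"
    by (simp add: a_def b_def c_def sin_diff algebra_simps)
  have 2: "a * sin m0 - b * sin m1 + c * sin m2 = 0"
    by (simp add: a_def b_def c_def sin_diff algebra_simps)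
  \<comment> \<open>The normal vectors cancel, so this combination is constant; but it is positive at \<open>p\<close> and negative at \<open>q\<close>.\<close>
  define h where "h z = a * chord R t0 t3 z - b * chord R t1 t4 z + c * chord R t2 t5 z" for z
  have "a * (dir m0 \<bullet> z) - b * (dir m1 \<bullet> z) + c * (dir m2 \<bullet> z) = 0" for z
  proof -
    have "a * (dir m0 \<bullet> z) - b * (dir m1 \<bullet> z) + c * (dir m2 \<bullet> z)
      = (a * cos m0 - b * cos m1 + c * cos m2) * z $ 1 + (a * sin m0 - b * sin m1 + c * sin m2) * z $ 2"
      by (simp add: inner_dir algebra_simps)
    then show ?thesis by (simp add: 1 2)
  qed
  then have "h z = - R * (a * cos ((t3 - t0) / 2) - b * cos ((t4 - t1) / 2) + c * cos ((t5 - t2) / 2))" for z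
    unfolding h_def chord_def m0_def m1_def m2_def
    by (simp add: algebra_simps)
  then have "h p = h q" by simp
  moreover have "0 < h p"
    using P pos mult_pos_pos[of a "chord R t0 t3 p"] mult_pos_neg[of b "chord R t1 t4 p"] mult_pos_pos[of c "chord R t2 t5 p"]
    unfolding h_def by linarith
  moreover have "h q < 0"
    using Q pos mult_pos_neg[of a "chord R t0 t3 q"] mult_pos_pos[of b "chord R t1 t4 q"] mult_pos_neg[of c "chord R t2 t5 q"]
    unfolding h_def by linarith
  ultimately show False by simp
qed

text \<open>The index \<open>of_nat j\<close> is taken modulo 6, so the division points continue periodically beyond \<open>k = 6\<close>.\<close>

definition angle :: "real ^ 6 \<Rightarrow> nat \<Rightarrow> real" where
  "angle x k = 2 * pi * (\<Sum>j<k. x $ of_nat j)"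

lemma bij_betw_of_nat_6: "bij_betw (of_nat :: nat \<Rightarrow> 6) {..<6} UNIV"
proof -
  have "i \<in> of_nat ` {..<6}" for i :: 6
  proof (cases i)
    case (of_int z)
    then show ?thesis
      by (intro image_eqI[where x = "nat z"]) auto
  qed
  then have surj: "(of_nat :: nat \<Rightarrow> 6) ` {..<6} = UNIV"
    by blast
  then have "inj_on (of_nat :: nat \<Rightarrow> 6) {..<6}"
    by (intro eq_card_imp_inj_on) auto
  then show ?thesis
    using surj by (simp add: bij_betw_def)
qed

lemma angle_period:
  assumes "(\<Sum>i\<in>UNIV. x $ i) = 1"
  shows "angle x (k + 6) = angle x k + 2 * pi"
proof (induction k)
  case 0
  show ?case
    using assms sum.reindex_bij_betw[OF bij_betw_of_nat_6, of "($) x"] by (simp add: angle_def)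
next
  case (Suc k)
  have "(of_nat (k + 6) :: 6) = of_nat k"
    by simp
  then have "angle x (Suc k + 6) = angle x (k + 6) + 2 * pi * x $ of_nat k"
    by (simp only: angle_def add_Suc sum.lessThan_Suc distrib_left)
  then show ?case
    using Suc by (simp add: angle_def distrib_left)
qed

lemma angle_mono: "x \<in> std_simplex \<Longrightarrow> k \<le> l \<Longrightarrow> angle x k \<le> angle x l"
  unfolding angle_def std_simplex_def by (intro mult_left_mono sum_mono2) auto

definition side :: "real \<Rightarrow> real ^ 6 \<Rightarrow> nat \<Rightarrow> real ^ 2 \<Rightarrow> real" where
  "side R x k = chord R (angle x k) (angle x (k + 3))"

text \<open>On the circle the two inequalities cut out the open arc between division points
  \<open>k\<close> and \<open>k + 1\<close>. The set is not cut down to the disc.\<close>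

definition sector :: "real \<Rightarrow> real ^ 6 \<Rightarrow> nat \<Rightarrow> (real ^ 2) set" where
  "sector R x k = {z. 0 < side R x k z \<and> side R x (Suc k) z < 0}"

lemma side_add_3:
  assumes "x \<in> std_simplex"
  shows "side R x (k + 3) z = - side R x k z"
proof -
  have "angle x (k + 3 + 3) = angle x k + 2 * pi"
    using angle_period[of x k] assms by (simp add: std_simplex_def add.assoc)
  then show ?thesis
    unfolding side_def by (simp only: chord_swap)
qed

text \<open>Over a degenerate arc both chords start at the same point and the second reaches at
  least as far, so inside the disc its function cannot be negative where the first is
  positive.\<close>

lemma sector_disjoint_ball:
  assumes x: "x \<in> std_simplex" "x $ of_nat k = 0" and z: "norm z < R"
  shows "z \<notin> sector R x k"
proof
  assume "z \<in> sector R x k"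
  then have 1: "0 < chord R (angle x k) (angle x (k + 3)) z"
    and 2: "chord R (angle x (Suc k)) (angle x (Suc k + 3)) z < 0"
    by (auto simp: sector_def side_def)
  have "angle x (Suc k) = angle x k"
    using x by (simp add: angle_def)
  moreover have "angle x (Suc k + 3) \<le> angle x k + 2 * pi"
    using angle_period[of x k] angle_mono[of x "Suc k + 3" "k + 6"] x by (simp add: std_simplex_def)
  ultimately have "0 \<le> chord R (angle x (Suc k)) (angle x (Suc k + 3)) z"
    using chord_pos_mono[OF z _ _ _ 1] angle_mono[of x] x by simp
  then show False
    using 2 by simp
qed

lemma continuous_on_side: "continuous_on UNIV (\<lambda>(x, z). side R x k z)"
  unfolding side_def chord_def inner_dir angle_def case_prod_unfold
  by (intro continuous_intros) auto

lemma openin_sector: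
  assumes "compact C"
  shows "openin (top_of_set std_simplex) {x \<in> std_simplex. C \<subseteq> sector R x k}"
proof -
  have "closed {w. side R (fst w) k (snd w) \<le> 0 \<or> 0 \<le> side R (fst w) (Suc k) (snd w)}"
    using continuous_on_side[of R k] continuous_on_side[of R "Suc k"] unfolding case_prod_unfold
    by (intro closed_Collect_disj closed_Collect_le continuous_intros)
  from closed_exists_compact[OF compact_std_simplex assms this]
  have "openin (top_of_set std_simplex) (std_simplex -
    {x \<in> std_simplex. \<exists>z\<in>C. side R x k z \<le> 0 \<or> 0 \<le> side R x (Suc k) z})"
    by (intro openin_diff closed_subset) auto
  also have "std_simplex - {x \<in> std_simplex. \<exists>z\<in>C. side R x k z \<le> 0 \<or> 0 \<le> side R x (Suc k) z} =
    {x \<in> std_simplex. C \<subseteq> sector R x k}"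
    by (auto simp: sector_def not_le)
  finally show ?thesis .
qed

lemma connected_same_side:
  assumes "connected C" "\<And>z. z \<in> C \<Longrightarrow> side R x k z \<noteq> 0"
  shows "(\<forall>z\<in>C. 0 < side R x k z) \<or> (\<forall>z\<in>C. side R x k z < 0)"
proof (rule ccontr)
  define n where "n = dir ((angle x k + angle x (k + 3)) / 2)"
  define c where "c = R * cos ((angle x (k + 3) - angle x k) / 2)"
  have side: "side R x k z = n \<bullet> z - c" for z
    by (simp add: side_def chord_def n_def c_def)
  assume "\<not> ?thesis"
  then obtain p q where "p \<in> C" "q \<in> C" "n \<bullet> p \<le> c" "c \<le> n \<bullet> q"
    unfolding side by force
  then obtain z where "z \<in> C" "n \<bullet> z = c"
    using connected_ivt_hyperplane[OF assms(1)] by blast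
  then show False
    using assms(2)[of z] side by simp
qed

text \<open>Each side has constant sign on \<open>C\<close>. Opposite sides have opposite signs, so
  going cyclically through all six, some positive side is followed by a negative one.\<close>

lemma connected_in_sector:
  assumes x: "x \<in> std_simplex" and C: "connected C"
    and avoid: "\<And>k z. k < 3 \<Longrightarrow> z \<in> C \<Longrightarrow> side R x k z \<noteq> 0"
  shows "\<exists>k<6. C \<subseteq> sector R x k"
proof -
  have s: "side R x 3 z = - side R x 0 z" "side R x 4 z = - side R x 1 z"
    "side R x 5 z = - side R x 2 z" "side R x 6 z = side R x 0 z" for z
    using side_add_3[OF x, of R 0] side_add_3[OF x, of R 1] side_add_3[OF x, of R 2]
      side_add_3[OF x, of R 3] by (simp_all add: numeral_eq_Suc)
  have "(\<forall>z\<in>C. 0 < side R x k z) \<or> (\<forall>z\<in>C. side R x k z < 0)" if "k < 3" for k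
    using connected_same_side[OF C] avoid[OF that] by blast
  from this[of 0] this[of 1] this[of 2]
  have "C \<subseteq> sector R x 0 \<or> C \<subseteq> sector R x 1 \<or> C \<subseteq> sector R x 2 \<or>
    C \<subseteq> sector R x 3 \<or> C \<subseteq> sector R x 4 \<or> C \<subseteq> sector R x 5"
    unfolding sector_def by (simp add: s subset_iff flip: numeral_2_eq_2) blast
  then show ?thesis
    by (elim disjE) (rule exI, rule conjI[rotated], assumption, simp)+
qed

section \<open>Finite families\<close>

text \<open>Each of the three points is separated from the other two by a line, so none of them is the middle one.\<close>

lemma chord_collinear_contradiction:
  assumes "collinear {p, q, r}"
    and "chord R a1 b1 p * chord R a1 b1 q \<le> 0" "0 < chord R a1 b1 q * chord R a1 b1 r"
    and "chord R a2 b2 q * chord R a2 b2 r \<le> 0" "0 < chord R a2 b2 r * chord R a2 b2 p"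
    and "chord R a3 b3 r * chord R a3 b3 p \<le> 0" "0 < chord R a3 b3 p * chord R a3 b3 q"
  shows False
proof -
  have aux: False
    if btw: "between (y, z) x" and "chord R a b x * chord R a b y \<le> 0" "0 < chord R a b y * chord R a b z"
    for a b x y z
  proof -
    let ?h = "chord R a b"
    obtain u where u: "0 \<le> u" "u \<le> 1" "x = (1 - u) *\<^sub>R y + u *\<^sub>R z"
      using btw by (auto simp: between_mem_segment in_segment)
    \<comment> \<open>The chord function is affine, so strictly equal signs at \<open>y\<close> and
      \<open>z\<close> carry over to every point between them.\<close>
    have "?h x = (1 - u) * ?h y + u * ?h z" (is "_ = ?c")
      by (simp add: u chord_def inner_simps algebra_simps)
    then have "?h x * ?h y = ?c * ?h y"
      by simp
    also have "\<dots> = (1 - u) * (?h y * ?h y) + u * (?h y * ?h z)"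
      by (simp add: algebra_simps)
    finally have eq: "?h x * ?h y = (1 - u) * (?h y * ?h y) + u * (?h y * ?h z)" .
    have "0 < ?h y * ?h y"
      using that(3) by (auto simp: zero_less_mult_iff)
    then have "0 < (1 - u) * (?h y * ?h y) + u * (?h y * ?h z)"
      using u that(3) by (cases "u = 0") (auto intro!: add_nonneg_pos)
    then show False
      using that(2) eq by linarith
  qed
  from assms(1) consider "between (q, r) p" | "between (r, p) q" | "between (p, q) r"
    unfolding collinear_between_cases by blast
  then show False
    by cases (rule aux[OF _ assms(2,3)] aux[OF _ assms(4,5)] aux[OF _ assms(6,7)], assumption)+
qed

text \<open>The three sets may coincide; taking them all equal shows that members are
  nonempty.\<close>

lemma property_T_collinear:
  assumes "property_T 3 G" "C1 \<in> G" "C2 \<in> G" "C3 \<in> G"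
  obtains p q r where "p \<in> C1" "q \<in> C2" "r \<in> C3" "collinear {p, q, r}"
proof -
  have "card {C1, C2, C3} \<le> 3"
    by (simp add: card_insert_if)
  then obtain L where L: "is_line L" "\<forall>C\<in>{C1, C2, C3}. L \<inter> C \<noteq> {}"
    using assms unfolding property_T_def
    by (metis (no_types, lifting) empty_subsetI finite.intros insert_subset)
  then obtain p q r where pqr: "p \<in> C1" "q \<in> C2" "r \<in> C3" "{p, q, r} \<subseteq> L"
    by auto
  have "collinear L"
    using L(1) by (simp add: is_line_def collinear_aff_dim)
  then have "collinear {p, q, r}"
    using pqr(4) collinear_subset by blast
  with pqr that show thesis by blast
qed

lemma three_lines_in_ball:
  assumes cpt: "\<And>C. C \<in> G \<Longrightarrow> compact C"
    and conn: "\<And>C. C \<in> G \<Longrightarrow> connected C" and T: "property_T 3 G"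
    and R: "\<And>C z. C \<in> G \<Longrightarrow> z \<in> C \<Longrightarrow> norm z < R"
  shows "\<exists>x\<in>std_simplex. \<forall>C\<in>G. \<exists>z\<in>C. \<exists>k<3. side R x k z = 0"
proof (rule ccontr)
  assume contra: "\<not> ?thesis"
  \<comment> \<open>The condition on \<open>k\<close> picks the natural number below 6 that
    represents \<open>i\<close>.\<close>
  define B where "B i = (\<Union>C\<in>G. \<Union>k\<in>{k. k < 6 \<and> of_nat k = i}. {x \<in> std_simplex. C \<subseteq> sector R x k})"
    for i :: 6
  have nonempty: "C \<noteq> {}" if "C \<in> G" for C
    using property_T_collinear[OF T that that that] by blast
  have "\<exists>x\<in>std_simplex. \<forall>i. x \<in> B i"
  proof (rule kkm_open)
    show "openin (top_of_set std_simplex) (B i)" for i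
      unfolding B_def using cpt by (blast intro: openin_sector)
    show "x $ i \<noteq> 0" if "x \<in> B i" for i x
    proof
      assume "x $ i = 0"
      obtain C k where "C \<in> G" "of_nat k = i" "x \<in> std_simplex" "C \<subseteq> sector R x k"
        using \<open>x \<in> B i\<close> by (auto simp: B_def)
      then show False
        using nonempty[of C] R[of C] sector_disjoint_ball[of x k _ R] \<open>x $ i = 0\<close> by blast
    qed
    show "std_simplex \<subseteq> (\<Union>i. B i)"
    proof
      fix x :: "real ^ 6" assume x: "x \<in> std_simplex"
      then obtain C where C: "C \<in> G" "\<And>z k. z \<in> C \<Longrightarrow> k < 3 \<Longrightarrow> side R x k z \<noteq> 0"
        using contra by blast
      then obtain k where "k < 6" "C \<subseteq> sector R x k"
        using connected_in_sector[OF x conn] by metis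
      then show "x \<in> (\<Union>i. B i)"
        using x C(1) by (auto simp: B_def)
    qed
  qed
  then obtain x where x: "x \<in> std_simplex" "\<And>i. x \<in> B i"
    by blast
  have sec: "\<exists>C\<in>G. C \<subseteq> sector R x k" if "k < 6" for k
  proof -
    have "inj_on (of_nat :: nat \<Rightarrow> 6) {..<6}"
      using bij_betw_of_nat_6 by (simp add: bij_betw_def)
    then have "l = k" if "l < 6" "(of_nat l :: 6) = of_nat k" for l
      using \<open>k < 6\<close> that by (auto dest: inj_onD)
    moreover obtain C l where "C \<in> G" "l < 6" "(of_nat l :: 6) = of_nat k" "C \<subseteq> sector R x l"
      using x(2)[of "of_nat k"] unfolding B_def by blast
    ultimately show ?thesis
      by blast
  qed
  \<comment> \<open>Every sector now contains a nonempty member inside the disc, so no arc is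
    degenerate and the division points are strictly ordered.\<close>
  have pos: "0 < x $ of_nat k" if k: "k < 6" for k
  proof -
    obtain C z where "C \<in> G" "z \<in> C" "z \<in> sector R x k"
      using sec[OF k] nonempty by blast
    then have "x $ of_nat k \<noteq> 0"
      using sector_disjoint_ball[OF x(1)] R by blast
    then show ?thesis
      using x(1) by (simp add: std_simplex_def less_le)
  qed
  have less: "angle x k < angle x (Suc k)" if "k < 6" for k
    using pos[OF that] by (simp add: angle_def)
  have angles: "angle x 0 < angle x 1" "angle x 1 < angle x 2" "angle x 2 < angle x 3"
    "angle x 3 < angle x 4" "angle x 4 < angle x 5" "angle x 5 < angle x 0 + 2 * pi"
    using less[of 0] less[of 1] less[of 2] less[of 3] less[of 4] less[of 5] angle_period[of x 0] x(1)
    by (simp_all add: numeral_eq_Suc std_simplex_def)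
  have alt: False
    if "0 < side R x 0 p" "side R x 1 p < 0" "0 < side R x 2 p"
      "side R x 0 q < 0" "0 < side R x 1 q" "side R x 2 q < 0" for p q
    using chords_alternating[OF angles] that by (simp add: side_def numeral_eq_Suc)
  have s: "side R x 3 z = - side R x 0 z" "side R x 4 z = - side R x 1 z"
    "side R x 5 z = - side R x 2 z" "side R x 6 z = side R x 0 z" for z
    using side_add_3[OF x(1), of R 0] side_add_3[OF x(1), of R 1] side_add_3[OF x(1), of R 2]
      side_add_3[OF x(1), of R 3] by (simp_all add: numeral_eq_Suc)
  have secs: "z \<in> sector R x 0 \<longleftrightarrow> 0 < side R x 0 z \<and> side R x 1 z < 0"
    "z \<in> sector R x 1 \<longleftrightarrow> 0 < side R x 1 z \<and> side R x 2 z < 0"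
    "z \<in> sector R x 2 \<longleftrightarrow> 0 < side R x 2 z \<and> 0 < side R x 0 z"
    "z \<in> sector R x 3 \<longleftrightarrow> side R x 0 z < 0 \<and> 0 < side R x 1 z"
    "z \<in> sector R x 4 \<longleftrightarrow> side R x 1 z < 0 \<and> 0 < side R x 2 z"
    "z \<in> sector R x 5 \<longleftrightarrow> side R x 2 z < 0 \<and> side R x 0 z < 0" for z
    by (simp_all add: sector_def s flip: numeral_2_eq_2)
  have triple: "\<exists>p q r. collinear {p, q, r} \<and> p \<in> sector R x i \<and> q \<in> sector R x j \<and> r \<in> sector R x k"
    if ijk: "i < 6" "j < 6" "k < 6" for i j k
  proof -
    obtain C1 C2 C3 where "C1 \<in> G" "C2 \<in> G" "C3 \<in> G"
      and sub: "C1 \<subseteq> sector R x i" "C2 \<subseteq> sector R x j" "C3 \<subseteq> sector R x k"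
      using sec[OF ijk(1)] sec[OF ijk(2)] sec[OF ijk(3)] by blast
    then obtain p q r where "p \<in> C1" "q \<in> C2" "r \<in> C3" "collinear {p, q, r}"
      using property_T_collinear[OF T] by metis
    then show ?thesis
      using sub by blast
  qed
  show False
  proof (cases "\<exists>p. 0 < side R x 0 p \<and> side R x 1 p < 0 \<and> 0 < side R x 2 p")
    case True
    then have no: "\<not> (side R x 0 z < 0 \<and> 0 < side R x 1 z \<and> side R x 2 z < 0)" for z
      using alt by blast
    obtain p q r where col: "collinear {p, q, r}"
      and "p \<in> sector R x 1" "q \<in> sector R x 3" "r \<in> sector R x 5"
      using triple[of 1 3 5] by auto
    then have "0 < side R x 1 p" "side R x 2 p < 0" "side R x 0 q < 0" "0 < side R x 1 q"
      "side R x 2 r < 0" "side R x 0 r < 0"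
      "0 \<le> side R x 0 p" "0 \<le> side R x 2 q" "side R x 1 r \<le> 0"
      using no[of p] no[of q] no[of r] unfolding secs by linarith+
    then show False
      using chord_collinear_contradiction[OF col, of R "angle x 0" "angle x (0 + 3)"
          "angle x 2" "angle x (2 + 3)" "angle x 1" "angle x (1 + 3)"]
      unfolding side_def by (simp add: mult_le_0_iff zero_less_mult_iff)
  next
    case False
    obtain p q r where col: "collinear {p, q, r}"
      and "p \<in> sector R x 0" "q \<in> sector R x 2" "r \<in> sector R x 4"
      using triple[of 0 2 4] by auto
    \<comment> \<open>Here the other pattern is excluded, and the separating lines for
      \<open>p\<close>, \<open>q\<close>, \<open>r\<close> are 2, 1 and 0.\<close>
    then have "0 < side R x 0 p" "side R x 1 p < 0" "0 < side R x 2 q" "0 < side R x 0 q"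
      "side R x 1 r < 0" "0 < side R x 2 r"
      "side R x 2 p \<le> 0" "0 \<le> side R x 1 q" "side R x 0 r \<le> 0"
      using False unfolding secs by (meson not_le less_imp_le)+
    then show False
      using chord_collinear_contradiction[OF col, of R "angle x 2" "angle x (2 + 3)"
          "angle x 1" "angle x (1 + 3)" "angle x 0" "angle x (0 + 3)"]
      unfolding side_def by (simp add: mult_le_0_iff zero_less_mult_iff)
  qed
qed

section \<open>Reduction to finite families\<close>

text \<open>Homogeneous coordinates: a normal vector and an offset. A zero normal with nonzero
  offset gives the empty set.\<close>

definition line_of :: "(real ^ 2) \<times> real \<Rightarrow> (real ^ 2) set" where
  "line_of w = {z. fst w \<bullet> z = snd w}"

lemma is_line_line_of: "fst w \<noteq> 0 \<Longrightarrow> is_line (line_of w)"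
  by (simp add: is_line_def line_of_def affine_hyperplane aff_dim_hyperplane)

lemma line_of_scaleR: "s \<noteq> 0 \<Longrightarrow> line_of (s *\<^sub>R w) = line_of w"
  by (auto simp: line_of_def)

lemma infinite_lines: "infinite {L. is_line L}"
proof -
  have "inj (\<lambda>c. line_of (dir 0, c))"
  proof (rule injI)
    fix c d :: real
    assume "line_of (dir 0, c) = line_of (dir 0, d)"
    moreover have unit: "dir 0 \<bullet> dir 0 = 1"
      by (simp flip: norm_eq_1)
    moreover have "c *\<^sub>R dir 0 \<in> line_of (dir 0, c)"
      by (simp add: line_of_def unit)
    ultimately show "c = d"
      by (simp add: line_of_def)
  qed
  then have "infinite (range (\<lambda>c. line_of (dir 0, c)))"
    using finite_imageD infinite_UNIV_char_0 by blast
  moreover have "range (\<lambda>c. line_of (dir 0, c)) \<subseteq> {L. is_line L}"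
  proof -
    have "dir 0 \<noteq> 0"
      by (metis norm_dir norm_zero zero_neq_one)
    then show ?thesis
      by (auto intro: is_line_line_of)
  qed
  ultimately show ?thesis
    using finite_subset by blast
qed

text \<open>Limits of triples may repeat a line or contain the line at infinity; arbitrary further
  lines fill the gaps.\<close>

lemma extend_to_three_lines:
  assumes "finite S" "card S \<le> 3" "S \<subseteq> {L. is_line L}"
  obtains L1 L2 L3 where "is_line L1" "is_line L2" "is_line L3" "distinct [L1, L2, L3]"
    "S \<subseteq> {L1, L2, L3}"
proof -
  obtain U where U: "finite U" "card U = 3" "U \<subseteq> {L. is_line L}"
    using infinite_arbitrarily_large[OF infinite_lines] by blast
  have "card U \<le> card (S \<union> U)"
    using assms U by (intro card_mono) auto
  then obtain T where T: "S \<subseteq> T" "T \<subseteq> S \<union> U" "card T = 3"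
    using exists_subset_between[of S 3 "S \<union> U"] assms U by auto
  then obtain L1 L2 L3 where "T = {L1, L2, L3}" "distinct [L1, L2, L3]"
    by (auto simp: card_3_iff)
  moreover have "T \<subseteq> {L. is_line L}"
    using T assms U by blast
  ultimately show thesis
    using T(1) that[of L1 L2 L3] by simp
qed

lemma finite_line_triple:
  assumes fin: "finite G" and cpt: "\<And>C. C \<in> G \<Longrightarrow> compact C"
    and conn: "\<And>C. C \<in> G \<Longrightarrow> connected C" and T: "property_T 3 G"
  shows "\<exists>w1\<in>sphere 0 1. \<exists>w2\<in>sphere 0 1. \<exists>w3\<in>sphere 0 1.
    \<forall>C\<in>G. C \<inter> (line_of w1 \<union> line_of w2 \<union> line_of w3) \<noteq> {}"
proof -
  have "bounded (\<Union>G)"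
    using fin cpt by (simp add: bounded_Union compact_imp_bounded)
  then obtain R where R: "\<And>z. z \<in> \<Union>G \<Longrightarrow> norm z < R"
    by (metis bounded_pos_less)
  obtain x where x: "\<forall>C\<in>G. \<exists>z\<in>C. \<exists>k<3. side R x k z = 0"
    using three_lines_in_ball[OF cpt conn T, of R] R by blast
  \<comment> \<open>Normal and offset read off from \<open>side\<close>; \<open>sgn\<close> then
    rescales them to the compact unit sphere without changing the line.\<close>
  define w where "w k = (dir ((angle x k + angle x (k + 3)) / 2), R * cos ((angle x (k + 3) - angle x k) / 2))" for k
  have nz: "w k \<noteq> 0" for k
    by (metis fst_zero fst_conv norm_dir norm_zero w_def zero_neq_one)
  have w: "side R x k z = 0 \<longleftrightarrow> z \<in> line_of (sgn (w k))" for k z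
    unfolding sgn_div_norm using nz by (subst line_of_scaleR) (auto simp: w_def line_of_def side_def chord_def)
  have sphere: "sgn (w k) \<in> sphere 0 1" for k
    using nz by (simp add: norm_sgn)
  have "C \<inter> (line_of (sgn (w 0)) \<union> line_of (sgn (w 1)) \<union> line_of (sgn (w 2))) \<noteq> {}" if C: "C \<in> G" for C
  proof -
    obtain z k where z: "z \<in> C" "k < 3" "z \<in> line_of (sgn (w k))"
      using x C w by blast
    then have "k = 0 \<or> k = 1 \<or> k = 2"
      by linarith
    then show ?thesis
      using z by blast
  qed
  then show ?thesis
    using sphere by blast
qed

lemma property_T_mono: "property_T k F \<Longrightarrow> G \<subseteq> F \<Longrightarrow> property_T k G"
  unfolding property_T_def by (meson subset_trans)

theorem mainTheorem2:
  fixes F :: "(real ^ 2) set set"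
  assumes "\<And>C. C \<in> F \<Longrightarrow> compact C"
    and "\<And>C. C \<in> F \<Longrightarrow> connected C"
    and "property_T 3 F"
  shows "\<exists>L1 L2 L3. is_line L1 \<and> is_line L2 \<and> is_line L3 \<and> distinct [L1, L2, L3] \<and>
           (\<forall>C \<in> F. (L1 \<union> L2 \<union> L3) \<inter> C \<noteq> {})"
proof -
  let ?S = "sphere (0 :: (real ^ 2) \<times> real) 1"
  define K where "K = ?S \<times> ?S \<times> ?S"
  define H where "H = {((w1, w2, w3), z). z \<in> line_of w1 \<union> line_of w2 \<union> line_of w3}"
  define hit where "hit C = {v \<in> K. \<exists>z\<in>C. (v, z) \<in> H}" for C
  have "compact K"
    by (simp add: K_def compact_Times)
  have "closed H"
    unfolding H_def line_of_def case_prod_unfold Un_iff mem_Collect_eq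
    by (intro closed_Collect_disj closed_Collect_eq continuous_intros)
  \<comment> \<open>Finite intersection property: each \<open>hit C\<close> is closed in the compact
    \<open>K\<close>, and finite subfamilies have a common triple.\<close>
  have "K \<inter> \<Inter> (hit ` F) \<noteq> {}"
  proof (rule compact_imp_fip_image[OF \<open>compact K\<close>])
    show "closed (hit C)" if "C \<in> F" for C
      unfolding hit_def using assms(1)[OF that] by (intro closed_exists_compact \<open>compact K\<close> \<open>closed H\<close>)
    fix G assume G: "finite G" "G \<subseteq> F"
    have "\<exists>w1\<in>?S. \<exists>w2\<in>?S. \<exists>w3\<in>?S.
      \<forall>C\<in>G. C \<inter> (line_of w1 \<union> line_of w2 \<union> line_of w3) \<noteq> {}"
      using G assms(1,2) by (intro finite_line_triple property_T_mono[OF assms(3)]) auto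
    then obtain w1 w2 w3 where "(w1, w2, w3) \<in> K"
      "\<forall>C\<in>G. C \<inter> (line_of w1 \<union> line_of w2 \<union> line_of w3) \<noteq> {}"
      unfolding K_def by blast
    then have "(w1, w2, w3) \<in> K \<inter> \<Inter> (hit ` G)"
      by (fastforce simp: hit_def H_def)
    then show "K \<inter> \<Inter> (hit ` G) \<noteq> {}"
      by blast
  qed
  then obtain v where "v \<in> K" "\<And>C. C \<in> F \<Longrightarrow> v \<in> hit C"
    by blast
  then obtain w1 w2 w3 where w: "(w1, w2, w3) \<in> K" "\<And>C. C \<in> F \<Longrightarrow> (w1, w2, w3) \<in> hit C"
    by (cases v) auto
  \<comment> \<open>A unit vector with vanishing first component stands for the line at infinity, which meets no \<^term>\<open>C\<close>.\<close>
  have proper: "fst w \<noteq> 0" if "w \<in> ?S" "z \<in> line_of w" for w z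
    using that by (cases w) (auto simp: line_of_def)
  define S where "S = line_of ` {w \<in> {w1, w2, w3}. fst w \<noteq> 0}"
  have "finite S"
    by (simp add: S_def)
  moreover have "card S \<le> 3"
  proof -
    have "card S \<le> card {w1, w2, w3}"
      unfolding S_def by (rule order_trans[OF card_image_le card_mono]) auto
    also have "\<dots> \<le> 3"
      by (simp add: card_insert_if)
    finally show ?thesis .
  qed
  moreover have "S \<subseteq> {L. is_line L}"
    by (auto simp: S_def is_line_line_of)
  ultimately obtain L1 L2 L3 where L: "is_line L1" "is_line L2" "is_line L3" "distinct [L1, L2, L3]"
    "S \<subseteq> {L1, L2, L3}"
    using extend_to_three_lines by metis
  have "(L1 \<union> L2 \<union> L3) \<inter> C \<noteq> {}" if C: "C \<in> F" for C
  proof -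
    obtain z w where z: "z \<in> C" "w \<in> {w1, w2, w3}" "z \<in> line_of w"
      using w(2)[OF C] unfolding hit_def H_def by blast
    then have "w \<in> ?S"
      using w(1) unfolding K_def by blast
    then have "fst w \<noteq> 0"
      using proper z(3) by blast
    then have "line_of w \<in> S"
      using z by (auto simp: S_def)
    then show ?thesis
      using z L(5) by blast
  qed
  then show ?thesis
    using L by blast
qed

end
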